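(* Let $a<b$, $c<d$, and let $f:\Delta=[a,b]\times[c,d]\to\mathbb{R}$ be a partially differentiable mapping on $\Delta$. If $\frac{\partial^2 f}{\partial t\partial s}\in L(\Delta)$, then the following equality holds: $$f\left(\frac{a+b}{2},\frac{c+d}{2}\right)-\frac{1}{d-c}\int_c^d f\left(\frac{a+b}{2},y\right)dy-\frac{1}{b-a}\int_a^b f\left(x,\frac{c+d}{2}\right)dx+\frac{1}{(b-a)(d-c)}\int_a^b\int_c^d f(x,y)\,dy\,dx$$ $$=\frac{1}{(b-a)(d-c)}\int_a^b\int_c^d p(x,t)\,q(y,s)\,\frac{\partial^2 f}{\partial t\partial s}\left(\frac{b-t}{b-a}a+\frac{t-a}{b-a}b,\ \frac{d-s}{d-c}c+\frac{s-c}{d-c}d\right)ds\,dt,$$ where, for each $x\in[a,b]$ and $y\in[c,d]$, $$p(x,t)=\begin{cases} t-a, & t\in\left[a,\frac{a+b}{2}\right],\\ t-b, & t\in\left(\frac{a+b}{2},b\right],\end{cases}\qquad q(y,s)=\begin{cases} s-c, & s\in\left[c,\frac{c+d}{2}\right],\\ s-d, & s\in\left(\frac{c+d}{2},d\right].\end{cases}$$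
   Context: $\frac{\partial^2 f}{\partial t\partial s}$ denotes the second-order mixed partial derivative of $f$ with respect to its first variable (written $t$) and its second variable (written $s$), and $L(\Delta)$ is the space of Lebesgue integrable functions on $\Delta$. The values of $p(x,t)$ and $q(y,s)$ do not depend on $x$ and $y$. *)

theory Defs
  imports "HOL-Analysis.Analysis"
begin

text \<open>
  Partial derivatives of a function on a set \<open>D\<close> in the plane are taken within the
  horizontal and vertical slices of \<open>D\<close>, so on the boundary of a rectangle they are one-sided
  and they never depend on values of the function outside \<open>D\<close>. The derivative operators are
  meaningful only at points where the corresponding differentiability predicate holds and that
  are not isolated in their slice.
\<close>

definition differentiable_fst_on :: "(real \<times> real \<Rightarrow> real) \<Rightarrow> (real \<times> real) set \<Rightarrow> bool" where
  "differentiable_fst_on f D \<longleftrightarrow>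
     (\<forall>t s. (t, s) \<in> D \<longrightarrow> (\<lambda>u. f (u, s)) differentiable (at t within {u. (u, s) \<in> D}))"

definition differentiable_snd_on :: "(real \<times> real \<Rightarrow> real) \<Rightarrow> (real \<times> real) set \<Rightarrow> bool" where
  "differentiable_snd_on f D \<longleftrightarrow>
     (\<forall>t s. (t, s) \<in> D \<longrightarrow> (\<lambda>v. f (t, v)) differentiable (at s within {v. (t, v) \<in> D}))"

definition partially_differentiable_on :: "(real \<times> real \<Rightarrow> real) \<Rightarrow> (real \<times> real) set \<Rightarrow> bool" where
  "partially_differentiable_on f D \<longleftrightarrow> differentiable_fst_on f D \<and> differentiable_snd_on f D"

definition partial_fst :: "(real \<times> real) set \<Rightarrow> (real \<times> real \<Rightarrow> real) \<Rightarrow> real \<times> real \<Rightarrow> real" where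
  "partial_fst D f = (\<lambda>(t, s). vector_derivative (\<lambda>u. f (u, s)) (at t within {u. (u, s) \<in> D}))"

definition partial_snd :: "(real \<times> real) set \<Rightarrow> (real \<times> real \<Rightarrow> real) \<Rightarrow> real \<times> real \<Rightarrow> real" where
  "partial_snd D f = (\<lambda>(t, s). vector_derivative (\<lambda>v. f (t, v)) (at s within {v. (t, v) \<in> D}))"

text \<open>
  The mixed derivative \<open>\<partial>\<^sup>2f/\<partial>t\<partial>s\<close> is \<open>\<partial>/\<partial>t (\<partial>f/\<partial>s)\<close>: first in the second
  variable, then in the first.
\<close>

definition mixed_partial :: "(real \<times> real) set \<Rightarrow> (real \<times> real \<Rightarrow> real) \<Rightarrow> real \<times> real \<Rightarrow> real" where
  "mixed_partial D f = partial_fst D (partial_snd D f)"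

definition has_mixed_partial_on :: "(real \<times> real \<Rightarrow> real) \<Rightarrow> (real \<times> real) set \<Rightarrow> bool" where
  "has_mixed_partial_on f D \<longleftrightarrow>
     differentiable_snd_on f D \<and> differentiable_fst_on (partial_snd D f) D"

end

theory Submission
  imports Defs
begin

text \<open>
  Write \<open>h\<close> for the mixed derivative. Two applications of the fundamental theorem of calculus (first
  in \<open>t\<close>, then in \<open>s\<close>) show that \<open>f (t, s)\<close> is \<open>f (a, s) + f (t, c) - f (a, c)\<close> plus the integral of
  \<open>h\<close> over \<open>[a, t] \<times> [c, s]\<close>. Each step needs only that the derivative exists everywhere, because the
  Henstock--Kurzweil integral recovers a function from it, and Fubini identifies the iterated
  integral with the Lebesgue one. The left-hand side is a linear functional of \<open>f\<close> that kills
  functions of a single variable, so only the double primitive of \<open>h\<close> contributes, and exchanging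
  integrals produces the kernel \<open>(1[u \<le> m] - (b - u) / (b - a)) = p u / (b - a)\<close>, where
  \<open>m = (a + b) / 2\<close>, and likewise in the second variable.
\<close>

section \<open>Borel representatives, the one-variable fundamental theorem and a Fubini
  formula\<close>

lemma integral_lebesgue_cong_AE:
  fixes f g :: "'a::euclidean_space \<Rightarrow> real"
  assumes "g \<in> borel_measurable lborel" "AE x in lborel. f x = g x"
  shows "integral\<^sup>L lebesgue f = integral\<^sup>L lborel g"
proof -
  have ae: "AE x in lebesgue. f x = g x"
    using assms(2) by (rule AE_completion)
  have g: "g \<in> borel_measurable lebesgue"
    using assms(1) by (rule measurable_completion)
  \<comment> \<open>Completeness of \<open>lebesgue\<close> enters here: agreement almost everywhere
    with a measurable function makes \<open>f\<close> itself measurable.\<close>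
  have f: "f \<in> borel_measurable lebesgue"
    using g by (rule borel_measurable_AE) (use ae in \<open>auto simp: eq_commute\<close>)
  have "integral\<^sup>L lebesgue f = integral\<^sup>L lebesgue g"
    using f g ae by (rule integral_cong_AE)
  also have "\<dots> = integral\<^sup>L lborel g"
    using assms(1) by (rule integral_completion)
  finally show ?thesis .
qed

text \<open>The indicator hides the values of \<open>f\<close> off \<open>A\<close>, so a formula
  valid only on \<open>A\<close> suffices. This reduces the set integrals over
  \<open>lebesgue\<close> to Bochner integrals over \<open>lborel\<close>.\<close>

lemma set_lebesgue_integral_eqI:
  fixes f :: "real \<Rightarrow> real"
  assumes "has_bochner_integral lborel (\<lambda>x. indicator A x * g x) I"
    and "\<And>x. x \<in> A \<Longrightarrow> f x = g x"
  shows "(LINT x:A|lebesgue. f x) = I"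
proof -
  have "(LINT x:A|lebesgue. f x) = (LINT x|lborel. indicator A x * g x)"
    unfolding set_lebesgue_integral_def
    by (rule integral_lebesgue_cong_AE)
      (use assms in \<open>auto simp: has_bochner_integral_iff indicator_def\<close>)
  then show ?thesis
    using assms(1) by (simp add: has_bochner_integral_iff)
qed

lemma has_bochner_integral_indicator_continuous:
  fixes g :: "real \<Rightarrow> real"
  assumes "continuous_on {a..b} g"
  shows "has_bochner_integral lborel (\<lambda>x. indicator {a..b} x * g x) (LINT x|lborel. indicator {a..b} x * g x)"
  using borel_integrable_atLeastAtMost'[OF assms]
  by (simp add: has_bochner_integral_iff set_integrable_def)

lemma has_bochner_integral_indicator_const:
  assumes "a \<le> b"
  shows "has_bochner_integral lborel (\<lambda>x. indicator {a..b} x * r) ((b - a) * r :: real)"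
  using has_bochner_integral_mult_left[OF has_bochner_integral_real_indicator[of "{a..b}" lborel], of r]
    assms by simp

text \<open>Since the derivative exists everywhere, its gauge integral is \<open>F b - F a\<close>
  without any integrability of \<open>f\<close>. Changing \<open>f\<close> to \<open>g\<close> on a
  null set preserves this, and the Lebesgue integral of \<open>g\<close> is also its gauge integral,
  so uniqueness equates the two.\<close>

lemma integral_derivative_AE:
  fixes F f g :: "real \<Rightarrow> real"
  assumes "a \<le> b"
    and "\<And>x. x \<in> {a..b} \<Longrightarrow> (F has_vector_derivative f x) (at x within {a..b})"
    and "integrable lborel g"
    and "AE x in lborel. x \<in> {a..b} \<longrightarrow> f x = g x"
  shows "(LINT x|lborel. indicator {a..b} x * g x) = F b - F a"
proof -
  define I where "I = (LINT x|lborel. indicator {a..b} x * g x)"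
  have "integrable lborel (\<lambda>x. indicator {a..b} x * g x)"
    using integrable_mult_indicator[OF _ assms(3), of "{a..b}"] by simp
  then have "((\<lambda>x. indicator {a..b} x * g x) has_integral I) UNIV"
    unfolding I_def by (rule has_integral_integral_lborel)
  also have "(\<lambda>x. indicator {a..b} x * g x) = (\<lambda>x. if x \<in> {a..b} then g x else 0)"
    by (auto simp: indicator_def)
  finally have "(g has_integral I) {a..b}"
    by (simp only: has_integral_restrict_UNIV)
  moreover have "(g has_integral (F b - F a)) {a..b}"
    using fundamental_theorem_of_calculus[OF assms(1,2)] has_integral_AE[OF assms(4)] by blast
  ultimately show ?thesis
    unfolding I_def by (rule has_integral_unique)
qed

text \<open>Fubini on the region \<open>c \<le> \<phi> z \<le> v \<le> d\<close>: the section at a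
  fixed \<open>z\<close> is an interval of length \<open>d - \<phi> z\<close>, which becomes the
  weight of \<open>k z\<close>. Below, \<open>\<phi>\<close> is one of the two coordinate
  projections.\<close>

lemma (in sigma_finite_measure) has_bochner_integral_sublevel:
  fixes k \<phi> :: "'a \<Rightarrow> real"
  assumes k: "integrable M k" and \<phi>[measurable]: "\<phi> \<in> borel_measurable M"
  shows "has_bochner_integral lborel
    (\<lambda>v. indicator {c..d} v * (LINT z|M. indicator {c..v} (\<phi> z) * k z))
    (LINT z|M. indicator {c..d} (\<phi> z) * (d - \<phi> z) * k z)"
proof -
  interpret P: pair_sigma_finite M lborel ..
  note [measurable] = borel_measurable_integrable[OF k]
  define F where "F = (\<lambda>z v. (if c \<le> \<phi> z \<and> \<phi> z \<le> v \<and> v \<le> d then k z else 0))"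
  have [measurable]: "case_prod F \<in> borel_measurable (M \<Otimes>\<^sub>M lborel)"
    unfolding F_def by measurable
  have F_section: "F z = (\<lambda>v. indicator {\<phi> z..d} v * (indicator {c..d} (\<phi> z) * k z))" for z
    by (auto simp: F_def indicator_def)
  have F_section': "(LINT z|M. F z v) = indicator {c..d} v * (LINT z|M. indicator {c..v} (\<phi> z) * k z)" for v
  proof -
    have "F z v = indicator {c..d} v * (indicator {c..v} (\<phi> z) * k z)" for z
      by (auto simp: F_def indicator_def)
    then show ?thesis by simp
  qed
  \<comment> \<open>If \<open>\<phi> z > d\<close>, the section is empty although
    \<open>d - \<phi> z\<close> is negative; the indicator of \<open>{c..d}\<close> makes the
    product zero.\<close>
  have sect: "has_bochner_integral lborel (F z) (indicator {c..d} (\<phi> z) * (d - \<phi> z) * k z)" for z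
  proof (cases "\<phi> z \<le> d")
    case True
    then show ?thesis
      using has_bochner_integral_indicator_const[of "\<phi> z" d "indicator {c..d} (\<phi> z) * k z"]
      unfolding F_section by (simp add: mult_ac)
  next
    case False
    then have "F z = (\<lambda>v. 0)" by (auto simp: F_section)
    with False show ?thesis by (simp add: has_bochner_integral_zero)
  qed
  have norm_sect: "has_bochner_integral lborel (\<lambda>v. norm (F z v))
      (norm (indicator {c..d} (\<phi> z) * (d - \<phi> z) * k z))" for z
  proof (cases "\<phi> z \<le> d")
    case True
    have "(\<lambda>v. norm (F z v)) = (\<lambda>v. indicator {\<phi> z..d} v * (indicator {c..d} (\<phi> z) * \<bar>k z\<bar>))"
      by (auto simp: F_section indicator_def)
    then show ?thesis
      using has_bochner_integral_indicator_const[OF True, of "indicator {c..d} (\<phi> z) * \<bar>k z\<bar>"] True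
      by (simp add: mult_ac abs_mult)
  next
    case False
    then have "F z = (\<lambda>v. 0)" by (auto simp: F_section)
    with False show ?thesis by (simp add: has_bochner_integral_zero)
  qed
  have int: "integrable (M \<Otimes>\<^sub>M lborel) (case_prod F)"
  proof (rule P.Fubini_integrable)
    have "integrable M (\<lambda>z. norm (indicator {c..d} (\<phi> z) * (d - \<phi> z) * k z))"
    proof (rule Bochner_Integration.integrable_bound)
      \<comment> \<open>Where the indicator is nonzero, \<open>d - \<phi> z\<close> lies between 0
        and \<open>d - c\<close>.\<close>
      show "integrable M (\<lambda>z. (d - c) * k z)" using k by simp
      show "AE z in M. norm (norm (indicator {c..d} (\<phi> z) * (d - \<phi> z) * k z)) \<le> norm ((d - c) * k z)"
        by (auto simp: indicator_def abs_mult intro!: mult_right_mono)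
    qed measurable
    then show "integrable M (\<lambda>z. LINT v|lborel. norm (case_prod F (z, v)))"
      using norm_sect by (simp add: has_bochner_integral_iff)
    show "AE z in M. integrable lborel (\<lambda>v. case_prod F (z, v))"
      using sect by (simp add: has_bochner_integral_iff)
  qed measurable
  show ?thesis
    using P.integrable_snd[OF int] P.Fubini_integral[OF int] sect
    by (simp add: has_bochner_integral_iff F_section')
qed

section \<open>Recovering a function from its mixed derivative, then averaging over the
  rectangle\<close>

lemma has_vector_derivative_partial_fst:
  assumes "differentiable_fst_on f (A \<times> B)" "t \<in> A" "s \<in> B"
  shows "((\<lambda>u. f (u, s)) has_vector_derivative partial_fst (A \<times> B) f (t, s)) (at t within A)"
  using assms vector_derivative_works[of "\<lambda>u. f (u, s)" "at t within A"]
  by (auto simp: differentiable_fst_on_def partial_fst_def)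

lemma has_vector_derivative_partial_snd:
  assumes "differentiable_snd_on f (A \<times> B)" "t \<in> A" "s \<in> B"
  shows "((\<lambda>v. f (t, v)) has_vector_derivative partial_snd (A \<times> B) f (t, s)) (at s within B)"
  using assms vector_derivative_works[of "\<lambda>v. f (t, v)" "at s within B"]
  by (auto simp: differentiable_snd_on_def partial_snd_def)

lemma mixed_partial_double_primitive:
  fixes f k :: "real \<times> real \<Rightarrow> real"
  assumes "has_mixed_partial_on f ({a..b} \<times> {c..d})"
    and k: "integrable lborel k"
    and ae: "AE z in lborel. z \<in> {a..b} \<times> {c..d} \<longrightarrow> mixed_partial ({a..b} \<times> {c..d}) f z = k z"
    and t: "t \<in> {a..b}" and s: "s \<in> {c..d}"
  shows "f (t, s) - f (a, s) - f (t, c) + f (a, c) =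
    (LINT z|lborel. indicator {a..t} (fst z) * (indicator {c..s} (snd z) * k z))"
proof -
  let ?D = "{a..b} \<times> {c..d}"
  define g where "g = partial_snd ?D f"
  define h where "h = mixed_partial ?D f"
  \<comment> \<open>The second variable comes first, so that the sections supplied by Fubini are
    integrable in \<open>u\<close> for almost every \<open>v\<close>.\<close>
  define K where "K = (\<lambda>(v, u). indicator {a..t} u * k (u, v))"
  have diff: "differentiable_snd_on f ?D" "differentiable_fst_on g ?D"
    using assms(1) by (auto simp: has_mixed_partial_on_def g_def)
  have g: "((\<lambda>v. f (u, v)) has_vector_derivative g (u, v)) (at v within {c..s})"
    if "u \<in> {a..b}" "v \<in> {c..s}" for u v
    using has_vector_derivative_partial_snd[OF diff(1), of u v] that s
    by (auto simp: g_def intro: has_vector_derivative_within_subset)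
  have h: "((\<lambda>u. g (u, v)) has_vector_derivative h (u, v)) (at u within {a..t})"
    if "u \<in> {a..t}" "v \<in> {c..d}" for u v
    using has_vector_derivative_partial_fst[OF diff(2), of u v] that t
    by (auto simp: g_def h_def mixed_partial_def intro: has_vector_derivative_within_subset)
  have kp: "integrable (lborel \<Otimes>\<^sub>M lborel) k"
    using k by (simp add: lborel_prod)
  have ksw: "integrable (lborel \<Otimes>\<^sub>M lborel) (\<lambda>(v, u). k (u, v))"
    using lborel_pair.integrable_product_swap[OF kp] .
  have ind: "indicator (UNIV \<times> {a..t}) (v, u) = (indicator {a..t} u :: real)" for u v :: real
    by (simp add: indicator_def)
  have K: "integrable (lborel \<Otimes>\<^sub>M lborel) K"
    using integrable_mult_indicator[OF _ ksw, of "UNIV \<times> {a..t}"]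
    by (simp add: K_def case_prod_beta' ind indicator_times)
  \<comment> \<open>Swapping coordinates preserves null sets of the plane, so for almost every
    height \<open>v\<close> the exceptional set on the horizontal line is null.\<close>
  have aesw: "AE v in lborel. AE u in lborel. (u, v) \<in> ?D \<longrightarrow> h (u, v) = k (u, v)"
  proof -
    have "AE z in lborel \<Otimes>\<^sub>M lborel. z \<in> ?D \<longrightarrow> h z = k z"
      unfolding lborel_prod h_def by (rule ae)
    then have "AE z in distr (lborel \<Otimes>\<^sub>M lborel) (lborel \<Otimes>\<^sub>M lborel) (\<lambda>(x, y). (y, x)). z \<in> ?D \<longrightarrow> h z = k z"
      by (subst lborel_pair.distr_pair_swap[symmetric])
    then have "AE z in lborel \<Otimes>\<^sub>M lborel. prod.swap z \<in> ?D \<longrightarrow> h (prod.swap z) = k (prod.swap z)"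
      by (auto dest!: AE_distrD[rotated] simp: case_prod_beta' prod.swap_def)
    from lborel_pair.AE_pair[OF this] show ?thesis by simp
  qed
  \<comment> \<open>First integration, in \<open>u\<close>. It is available only for almost every
    \<open>v\<close>, which is all that the second integration asks for.\<close>
  have "AE v in lborel. v \<in> {c..s} \<longrightarrow> g (t, v) - g (a, v) = (LINT u|lborel. K (v, u))"
    using aesw lborel_pair.AE_integrable_fst'[OF ksw]
  proof eventually_elim
    case (elim v)
    show ?case
    proof
      assume v: "v \<in> {c..s}"
      have "(LINT u|lborel. indicator {a..t} u * k (u, v)) = g (t, v) - g (a, v)"
      proof (rule integral_derivative_AE)
        show "AE u in lborel. u \<in> {a..t} \<longrightarrow> h (u, v) = k (u, v)"
          using elim(1) by eventually_elim (use v s t in auto)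
        show "integrable lborel (\<lambda>u. k (u, v))" using elim(2) by simp
      qed (use t v s h in auto)
      then show "g (t, v) - g (a, v) = (LINT u|lborel. K (v, u))"
        by (simp add: K_def)
    qed
  qed
  \<comment> \<open>Second integration: \<open>f (t, v) - f (a, v)\<close> has derivative
    \<open>g (t, v) - g (a, v)\<close> at every \<open>v\<close>, and the inner integral of
    \<open>K\<close> is an integrable version of it.\<close>
  then have "(LINT v|lborel. indicator {c..s} v * (LINT u|lborel. K (v, u))) =
      (f (t, s) - f (a, s)) - (f (t, c) - f (a, c))"
    using s t lborel_pair.integrable_fst'[OF K]
    by (intro integral_derivative_AE[where f = "\<lambda>v. g (t, v) - g (a, v)"])
      (auto intro!: has_vector_derivative_diff g)
  moreover have "(LINT v|lborel. indicator {c..s} v * (LINT u|lborel. K (v, u))) =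
      (LINT z|lborel. indicator {a..t} (fst z) * (indicator {c..s} (snd z) * k z))"
  proof -
    define L where "L = (\<lambda>u v. indicator {c..s} v * (indicator {a..t} u * k (u, v)))"
    have "integrable (lborel \<Otimes>\<^sub>M lborel) (case_prod L)"
      using integrable_mult_indicator[OF _ kp, of "{a..t} \<times> {c..s}"]
      by (simp add: L_def case_prod_beta' indicator_times mult_ac)
    then have "(LINT v|lborel. LINT u|lborel. L u v) = (LINT z|lborel. case_prod L z)"
      by (simp only: lborel_pair.integral_snd lborel_prod)
    moreover have "case_prod L z = indicator {a..t} (fst z) * (indicator {c..s} (snd z) * k z)" for z
      by (simp add: L_def case_prod_beta' mult.left_commute)
    ultimately show ?thesis
      by (simp add: L_def K_def)
  qed
  ultimately show ?thesis by simp
qed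

text \<open>The contributions of \<open>A\<close> and \<open>B\<close> cancel. Integrating the
  double primitive over an upper limit replaces an indicator by the weight \<open>b - u\<close> or
  \<open>d - v\<close>, so the four remaining terms are the expansion of a product of two
  one-variable kernels.\<close>

lemma mid_functional_double_primitive:
  fixes f k :: "real \<times> real \<Rightarrow> real" and A B :: "real \<Rightarrow> real"
  assumes ab: "a < b" and cd: "c < d" and m: "m \<in> {a..b}" and n: "n \<in> {c..d}"
    and k: "integrable lborel k"
    and A: "continuous_on {c..d} A" and B: "continuous_on {a..b} B"
    and f: "\<And>t s. t \<in> {a..b} \<Longrightarrow> s \<in> {c..d} \<Longrightarrow> f (t, s) = A s + B t +
      (LINT z|lborel. indicator {a..t} (fst z) * (indicator {c..s} (snd z) * k z))"
  shows "f (m, n)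
     - 1 / (d - c) * (LINT v:{c..d}|lebesgue. f (m, v))
     - 1 / (b - a) * (LINT u:{a..b}|lebesgue. f (u, n))
     + 1 / ((b - a) * (d - c)) * (LINT u:{a..b}|lebesgue. (LINT v:{c..d}|lebesgue. f (u, v)))
     = 1 / ((b - a) * (d - c)) * (LINT z|lborel.
        (indicator {a..b} (fst z) * (if fst z \<le> m then fst z - a else fst z - b)) *
        (indicator {c..d} (snd z) * (if snd z \<le> n then snd z - c else snd z - d)) * k z)"
proof -
  note [measurable] = borel_measurable_integrable[OF k]
  have proj: "fst \<in> borel_measurable (lborel :: (real \<times> real) measure)"
    "snd \<in> borel_measurable (lborel :: (real \<times> real) measure)"
    by (simp_all flip: borel_prod)
  \<comment> \<open>\<open>kx\<close> and \<open>ky\<close> truncate \<open>k\<close> in one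
    variable, leaving the other free for integration. \<open>Y\<close> is \<open>k\<close> after
    integrating out the upper limit in the second variable, whereas \<open>X\<close> is only the
    weight from the first, so \<open>X z * Y z\<close> has both limits integrated out.\<close>
  define kx where "kx t z = indicator {a..t} (fst z) * k z" for t :: real and z :: "real \<times> real"
  define ky where "ky s z = indicator {c..s} (snd z) * k z" for s :: real and z :: "real \<times> real"
  define Y where "Y z = indicator {c..d} (snd z) * (d - snd z) * k z" for z :: "real \<times> real"
  define X where "X z = indicator {a..b} (fst z) * (b - fst z)" for z :: "real \<times> real"
  have bnd: "integrable lborel (\<lambda>z. w z * r z)"
    if "integrable lborel r" "w \<in> borel_measurable (borel \<Otimes>\<^sub>M borel)" "\<And>z. \<bar>w z\<bar> \<le> C"
    for w r :: "real \<times> real \<Rightarrow> real" and C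
  proof (rule Bochner_Integration.integrable_bound)
    show "integrable lborel (\<lambda>z. C * r z)" using that by simp
    have "C \<ge> 0" using that(3)[of undefined] by linarith
    then show "AE z in lborel. norm (w z * r z) \<le> norm (C * r z)"
      using that(3) by (auto simp: abs_mult intro!: mult_right_mono)
  qed (use that in \<open>auto simp: borel_prod\<close>)
  have kx: "integrable lborel (kx t)" for t
    unfolding kx_def by (rule bnd[OF k, where C = 1]) (simp, auto simp: indicator_def)
  have ky: "integrable lborel (ky s)" for s
    unfolding ky_def by (rule bnd[OF k, where C = 1]) (simp, auto simp: indicator_def)
  have Y: "integrable lborel Y"
    unfolding Y_def by (rule bnd[OF k, where C = "d - c"]) (simp, use cd in \<open>auto simp: indicator_def\<close>)
  define SA where "SA = (LINT v|lborel. indicator {c..d} v * A v)"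
  define SB where "SB = (LINT u|lborel. indicator {a..b} u * B u)"
  \<comment> \<open>The double primitive contributes \<open>H\<close> at the point,
    \<open>G m\<close> and \<open>W\<close> when integrated along the vertical and horizontal line
    through it, and \<open>V\<close> when integrated over the rectangle.\<close>
  define G where "G t = (LINT z|lborel. indicator {a..t} (fst z) * Y z)" for t
  define H where "H = (LINT z|lborel. indicator {a..m} (fst z) * (indicator {c..n} (snd z) * k z))"
  define W where "W = (LINT z|lborel. X z * ky n z)"
  define V where "V = (LINT z|lborel. X z * Y z)"
  have intA: "has_bochner_integral lborel (\<lambda>v. indicator {c..d} v * A v) SA"
    unfolding SA_def by (rule has_bochner_integral_indicator_continuous[OF A])
  have intB: "has_bochner_integral lborel (\<lambda>u. indicator {a..b} u * B u) SB"
    unfolding SB_def by (rule has_bochner_integral_indicator_continuous[OF B])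
  \<comment> \<open>Needed for all \<open>t\<close>: at \<open>t = m\<close> it gives the single
    integral, and under the outer integral the double one.\<close>
  have inner: "(LINT v:{c..d}|lebesgue. f (t, v)) = SA + (d - c) * B t + G t"
    if t: "t \<in> {a..b}" for t
  proof (rule set_lebesgue_integral_eqI)
    have "has_bochner_integral lborel
        (\<lambda>v. indicator {c..d} v * (LINT z|lborel. indicator {c..v} (snd z) * kx t z)) (G t)"
      using lborel.has_bochner_integral_sublevel[OF kx[of t] proj(2), of c d]
      by (simp add: G_def Y_def kx_def mult_ac)
    with intA has_bochner_integral_indicator_const[of c d "B t"] cd
    show "has_bochner_integral lborel
        (\<lambda>v. indicator {c..d} v * (A v + B t + (LINT z|lborel. indicator {c..v} (snd z) * kx t z)))
        (SA + (d - c) * B t + G t)"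
      by (simp add: distrib_left has_bochner_integral_add)
  qed (use t in \<open>simp add: f kx_def mult.left_commute\<close>)
  have "(LINT u:{a..b}|lebesgue. f (u, n)) = (b - a) * A n + SB + W"
  proof (rule set_lebesgue_integral_eqI)
    have "has_bochner_integral lborel
        (\<lambda>u. indicator {a..b} u * (LINT z|lborel. indicator {a..u} (fst z) * ky n z)) W"
      using lborel.has_bochner_integral_sublevel[OF ky[of n] proj(1), of a b]
      by (simp add: W_def X_def)
    with intB has_bochner_integral_indicator_const[of a b "A n"] ab
    show "has_bochner_integral lborel
        (\<lambda>u. indicator {a..b} u * (A n + B u + (LINT z|lborel. indicator {a..u} (fst z) * ky n z)))
        ((b - a) * A n + SB + W)"
      by (simp add: distrib_left has_bochner_integral_add)
  qed (use n in \<open>simp add: f ky_def\<close>)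
  moreover have "(LINT u:{a..b}|lebesgue. (LINT v:{c..d}|lebesgue. f (u, v)))
      = (b - a) * SA + (d - c) * SB + V"
  proof (rule set_lebesgue_integral_eqI)
    have "has_bochner_integral lborel (\<lambda>u. indicator {a..b} u * G u) V"
      using lborel.has_bochner_integral_sublevel[OF Y proj(1), of a b]
      by (simp add: V_def X_def G_def)
    with has_bochner_integral_mult_right[OF intB, of "d - c"]
      has_bochner_integral_indicator_const[of a b SA] ab
    show "has_bochner_integral lborel
        (\<lambda>u. indicator {a..b} u * (SA + (d - c) * B u + G u))
        ((b - a) * SA + (d - c) * SB + V)"
      by (simp add: distrib_left has_bochner_integral_add mult.left_commute)
  qed (rule inner)
  moreover have "f (m, n) = A n + B m + H"
    using f[OF m n] by (simp add: H_def)
  moreover have "H - 1 / (d - c) * G m - 1 / (b - a) * W + 1 / ((b - a) * (d - c)) * V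
     = 1 / ((b - a) * (d - c)) * (LINT z|lborel.
        (indicator {a..b} (fst z) * (if fst z \<le> m then fst z - a else fst z - b)) *
        (indicator {c..d} (snd z) * (if snd z \<le> n then snd z - c else snd z - d)) * k z)"
    (is "_ = _ * ?R")
  proof -
    have iH: "integrable lborel (\<lambda>z. indicator {a..m} (fst z) * ky n z)"
      by (rule bnd[OF ky, where C = 1]) (simp, auto simp: indicator_def)
    have iG: "integrable lborel (\<lambda>z. indicator {a..m} (fst z) * Y z)"
      by (rule bnd[OF Y, where C = 1]) (simp, auto simp: indicator_def)
    have iW: "integrable lborel (\<lambda>z. X z * ky n z)"
      unfolding X_def by (rule bnd[OF ky, where C = "b - a"]) (simp, use ab in \<open>auto simp: indicator_def\<close>)
    have iV: "integrable lborel (\<lambda>z. X z * Y z)"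
      unfolding X_def by (rule bnd[OF Y, where C = "b - a"]) (simp, use ab in \<open>auto simp: indicator_def\<close>)
    have "?R = (LINT z|lborel. (b - a) * (d - c) * (indicator {a..m} (fst z) * ky n z)
        - (b - a) * (indicator {a..m} (fst z) * Y z) - (d - c) * (X z * ky n z) + X z * Y z)"
    proof (rule Bochner_Integration.integral_cong)
      fix z :: "real \<times> real"
      \<comment> \<open>Up to \<open>m\<close> this reads \<open>(b - a) - (b - u) = u - a\<close>;
        beyond \<open>m\<close> only \<open>-(b - u) = u - b\<close> remains.\<close>
      have "indicator {a..b} (fst z) * (if fst z \<le> m then fst z - a else fst z - b)
          = (b - a) * indicator {a..m} (fst z) - X z"
        using m by (auto simp: X_def indicator_def)
      moreover have "indicator {c..d} (snd z) * (if snd z \<le> n then snd z - c else snd z - d) * k z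
          = (d - c) * ky n z - Y z"
        using n by (auto simp: Y_def ky_def indicator_def algebra_simps)
      ultimately show "(indicator {a..b} (fst z) * (if fst z \<le> m then fst z - a else fst z - b)) *
        (indicator {c..d} (snd z) * (if snd z \<le> n then snd z - c else snd z - d)) * k z =
        (b - a) * (d - c) * (indicator {a..m} (fst z) * ky n z)
        - (b - a) * (indicator {a..m} (fst z) * Y z) - (d - c) * (X z * ky n z) + X z * Y z"
        by (simp only: mult.assoc) (simp add: algebra_simps)
    qed simp
    also have "\<dots> = (b - a) * (d - c) * H - (b - a) * G m - (d - c) * W + V"
      using iH iG iW iV by (simp add: H_def G_def W_def V_def ky_def)
    finally have R: "?R = (b - a) * (d - c) * H - (b - a) * G m - (d - c) * W + V" .
    \<comment> \<open>The side lengths become atoms \<open>\<alpha>\<close> and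
      \<open>\<beta>\<close>, so that clearing denominators does not expand the differences.\<close>
    have "H - 1 / \<beta> * G m - 1 / \<alpha> * W + 1 / (\<alpha> * \<beta>) * V
        = 1 / (\<alpha> * \<beta>) * (\<alpha> * \<beta> * H - \<alpha> * G m - \<beta> * W + V)" if "\<alpha> \<noteq> 0" "\<beta> \<noteq> 0" for \<alpha> \<beta>
      using that by (simp add: field_simps)
    with ab cd show ?thesis
      unfolding R by simp
  qed
  \<comment> \<open>The cancellation of every term in \<open>A\<close>, \<open>B\<close>,
    \<open>SA\<close> and \<open>SB\<close>.\<close>
  moreover have "A n + B m + H - 1 / (d - c) * (SA + (d - c) * B m + G m)
      - 1 / (b - a) * ((b - a) * A n + SB + W)
      + 1 / ((b - a) * (d - c)) * ((b - a) * SA + (d - c) * SB + V)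
      = H - 1 / (d - c) * G m - 1 / (b - a) * W + 1 / ((b - a) * (d - c)) * V"
  proof -
    have "A n + B m + H - 1 / \<beta> * (SA + \<beta> * B m + G m) - 1 / \<alpha> * (\<alpha> * A n + SB + W)
      + 1 / (\<alpha> * \<beta>) * (\<alpha> * SA + \<beta> * SB + V) = H - 1 / \<beta> * G m - 1 / \<alpha> * W + 1 / (\<alpha> * \<beta>) * V"
      if "\<alpha> \<noteq> 0" "\<beta> \<noteq> 0" for \<alpha> \<beta>
      using that by (simp add: field_simps)
    from this[of "b - a" "d - c"] ab cd show ?thesis by simp
  qed
  ultimately show ?thesis
    by (simp only: inner[OF m])
qed


section \<open>The midpoint identity: a Borel version of the mixed derivative and matching
  kernels\<close>

theorem lemma1:
  fixes a b c d :: real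
    and f :: "real \<times> real \<Rightarrow> real"
    and \<Delta> :: "(real \<times> real) set"
    and p q :: "real \<Rightarrow> real \<Rightarrow> real"
  assumes "a < b" and "c < d"
    and "\<Delta> = {a..b} \<times> {c..d}"
    and "partially_differentiable_on f \<Delta>"
    and "has_mixed_partial_on f \<Delta>"
    and "set_integrable lebesgue \<Delta> (mixed_partial \<Delta> f)"
    and "\<And>x t. x \<in> {a..b} \<Longrightarrow> t \<in> {a..(a + b) / 2} \<Longrightarrow> p x t = t - a"
    and "\<And>x t. x \<in> {a..b} \<Longrightarrow> t \<in> {(a + b) / 2<..b} \<Longrightarrow> p x t = t - b"
    and "\<And>y s. y \<in> {c..d} \<Longrightarrow> s \<in> {c..(c + d) / 2} \<Longrightarrow> q y s = s - c"
    and "\<And>y s. y \<in> {c..d} \<Longrightarrow> s \<in> {(c + d) / 2<..d} \<Longrightarrow> q y s = s - d"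
  shows "\<forall>x\<in>{a..b}. \<forall>y\<in>{c..d}.
     f ((a + b) / 2, (c + d) / 2)
     - 1 / (d - c) * (LINT v:{c..d}|lebesgue. f ((a + b) / 2, v))
     - 1 / (b - a) * (LINT u:{a..b}|lebesgue. f (u, (c + d) / 2))
     + 1 / ((b - a) * (d - c)) * (LINT u:{a..b}|lebesgue. (LINT v:{c..d}|lebesgue. f (u, v)))
     = 1 / ((b - a) * (d - c)) *
       (LINT t:{a..b}|lebesgue. (LINT s:{c..d}|lebesgue.
          p x t * q y s *
          mixed_partial \<Delta> f
            ((b - t) / (b - a) * a + (t - a) / (b - a) * b,
             (d - s) / (d - c) * c + (s - c) / (d - c) * d)))"
proof (intro ballI)
  fix x y assume x: "x \<in> {a..b}" and y: "y \<in> {c..d}"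
  note ab = assms(1) and cd = assms(2) and \<Delta> = assms(3)
  define m where "m = (a + b) / 2"
  define n where "n = (c + d) / 2"
  define h where "h = mixed_partial \<Delta> f"
  \<comment> \<open>\<open>p x\<close> and \<open>q y\<close> are prescribed only on the intervals;
    cut off by zero they become the globally Borel kernels \<open>P\<close> and
    \<open>Q\<close>.\<close>
  define P where "P t = indicator {a..b} t * (if t \<le> m then t - a else t - b)" for t
  define Q where "Q s = indicator {c..d} s * (if s \<le> n then s - c else s - d)" for s
  have [measurable]: "P \<in> borel_measurable lborel" "Q \<in> borel_measurable lborel"
    unfolding P_def Q_def by measurable
  have p: "indicator {a..b} t * p x t = P t" for t
    using assms(7,8)[OF x] by (auto simp: P_def m_def indicator_def)
  have q: "indicator {c..d} s * q y s = Q s" for s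
    using assms(9,10)[OF y] by (auto simp: Q_def n_def indicator_def)
  have m: "m \<in> {a..b}" and n: "n \<in> {c..d}"
    using ab cd by (auto simp: m_def n_def)
  have h0: "integrable lebesgue (\<lambda>z. indicator \<Delta> z * h z)"
    using assms(6) by (simp add: set_integrable_def h_def)
  \<comment> \<open>The mixed derivative is only Lebesgue measurable. Extended by zero off
    \<open>\<Delta>\<close>, it has a Borel version \<open>k\<close>, to which the product theory of
    \<open>lborel\<close> applies.\<close>
  obtain k where kb[measurable]: "k \<in> borel_measurable lborel"
    and hk: "AE z in lborel. indicator \<Delta> z * h z = k z"
    using completion_ex_borel_measurable_real[OF borel_measurable_integrable[OF h0]] by blast
  have k: "integrable lborel k"
  proof -
    have kl: "k \<in> borel_measurable lebesgue"
      using kb by (rule measurable_completion)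
    have "integrable lebesgue k"
      using h0 kl by (rule integrable_cong_AE_imp) (use AE_completion[OF hk] in \<open>auto simp: eq_commute\<close>)
    then show ?thesis
      using kb by (simp add: integrable_completion)
  qed
  have ae: "AE z in lborel. z \<in> \<Delta> \<longrightarrow> h z = k z"
    using hk by eventually_elim auto
  \<comment> \<open>The one-variable parts are the boundary data \<open>f (a, s)\<close> and
    \<open>f (t, c) - f (a, c)\<close>, which partial differentiability makes continuous.\<close>
  have f: "f (t, s) = f (a, s) + (f (t, c) - f (a, c)) +
      (LINT z|lborel. indicator {a..t} (fst z) * (indicator {c..s} (snd z) * k z))"
    if "t \<in> {a..b}" "s \<in> {c..d}" for t s
    using mixed_partial_double_primitive[of f a b c d k t s] assms(5) k ae that
    by (simp add: \<Delta> h_def)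
  have diff: "differentiable_fst_on f ({a..b} \<times> {c..d})" "differentiable_snd_on f ({a..b} \<times> {c..d})"
    using assms(4) by (auto simp: partially_differentiable_on_def \<Delta>)
  have A: "continuous_on {c..d} (\<lambda>s. f (a, s))"
    using has_vector_derivative_partial_snd[OF diff(2), of a] ab
    by (intro continuous_on_vector_derivative) auto
  have "continuous_on {a..b} (\<lambda>t. f (t, c))"
    using has_vector_derivative_partial_fst[OF diff(1), of _ c] cd
    by (intro continuous_on_vector_derivative) auto
  then have B: "continuous_on {a..b} (\<lambda>t. f (t, c) - f (a, c))"
    by (intro continuous_intros)
  have rhs: "(LINT t:{a..b}|lebesgue. (LINT s:{c..d}|lebesgue.
          p x t * q y s *
          mixed_partial \<Delta> f
            ((b - t) / (b - a) * a + (t - a) / (b - a) * b,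
             (d - s) / (d - c) * c + (s - c) / (d - c) * d)))
      = (LINT z|lborel. P (fst z) * Q (snd z) * k z)"
  proof -
    \<comment> \<open>The convex combinations reparametrise each interval by the identity.\<close>
    have conv: "(b - t) / (b - a) * a + (t - a) / (b - a) * b = t"
      "(d - s) / (d - c) * c + (s - c) / (d - c) * d = s" for t s
      using ab cd by (simp_all add: divide_simps) (simp_all add: algebra_simps)
    have [measurable]: "k \<in> borel_measurable (lborel \<Otimes>\<^sub>M lborel)"
      using kb by (simp add: lborel_prod)
    have "AE z in lborel \<Otimes>\<^sub>M lborel. z \<in> \<Delta> \<longrightarrow> h z = k z"
      unfolding lborel_prod by (rule ae)
    then have "AE t in lborel. AE s in lborel. (t, s) \<in> \<Delta> \<longrightarrow> h (t, s) = k (t, s)"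
      by (rule lborel_pair.AE_pair)
    \<comment> \<open>Passing to \<open>k\<close> takes two layers: for almost every
      \<open>t\<close> the inner integrands agree for almost every \<open>s\<close>, and then the
      inner integrals agree as functions of \<open>t\<close> almost everywhere.\<close>
    then have "AE t in lborel. indicator {a..b} t *\<^sub>R (LINT s:{c..d}|lebesgue. p x t * q y s * h (t, s))
        = (LINT s|lborel. P t * Q s * k (t, s))"
    proof eventually_elim
      case (elim t)
      show ?case
      proof (cases "t \<in> {a..b}")
        case True
        then have pt: "p x t = P t" using p[of t] by simp
        have "(LINT s:{c..d}|lebesgue. p x t * q y s * h (t, s)) = (LINT s|lborel. P t * Q s * k (t, s))"
          unfolding set_lebesgue_integral_def
        proof (rule integral_lebesgue_cong_AE)
          show "AE s in lborel. indicator {c..d} s *\<^sub>R (p x t * q y s * h (t, s)) = P t * Q s * k (t, s)"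
            using elim
          proof eventually_elim
            case (elim s)
            show ?case
              using elim True q[of s] by (cases "s \<in> {c..d}") (auto simp: pt \<Delta>)
          qed
        qed measurable
        with True show ?thesis by simp
      next
        case False
        then show ?thesis by (simp add: P_def)
      qed
    qed
    then have "(LINT t:{a..b}|lebesgue. (LINT s:{c..d}|lebesgue. p x t * q y s * h (t, s)))
        = (LINT t|lborel. LINT s|lborel. P t * Q s * k (t, s))"
      unfolding set_lebesgue_integral_def[of _ "{a..b}"]
      by (intro integral_lebesgue_cong_AE) measurable
    also have "\<dots> = (LINT z|lborel. P (fst z) * Q (snd z) * k z)"
    proof -
      have "integrable (lborel \<Otimes>\<^sub>M lborel) (\<lambda>z. P (fst z) * Q (snd z) * k z)"
      proof (rule Bochner_Integration.integrable_bound)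
        show "integrable (lborel \<Otimes>\<^sub>M lborel) (\<lambda>z. (b - a) * (d - c) * k z)"
          using k by (simp add: lborel_prod)
        \<comment> \<open>These crude bounds dominate the integrand by a multiple of
          \<open>k\<close>, which justifies Fubini.\<close>
        have "\<bar>P t\<bar> \<le> b - a" "\<bar>Q s\<bar> \<le> d - c" for t s
          using ab cd m n by (auto simp: P_def Q_def indicator_def)
        then have "\<bar>P t\<bar> * \<bar>Q s\<bar> \<le> (b - a) * (d - c)" for t s
          using ab by (intro mult_mono) auto
        then show "AE z in lborel \<Otimes>\<^sub>M lborel. norm (P (fst z) * Q (snd z) * k z) \<le> norm ((b - a) * (d - c) * k z)"
          using ab cd by (auto simp: abs_mult intro!: mult_right_mono)
      qed measurable
      from lborel_pair.integral_fst'[OF this] show ?thesis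
        by (simp add: lborel_prod)
    qed
    finally show ?thesis
      unfolding conv h_def .
  qed
  have "f (m, n)
     - 1 / (d - c) * (LINT v:{c..d}|lebesgue. f (m, v))
     - 1 / (b - a) * (LINT u:{a..b}|lebesgue. f (u, n))
     + 1 / ((b - a) * (d - c)) * (LINT u:{a..b}|lebesgue. (LINT v:{c..d}|lebesgue. f (u, v)))
     = 1 / ((b - a) * (d - c)) * (LINT z|lborel. P (fst z) * Q (snd z) * k z)"
    unfolding P_def Q_def by (rule mid_functional_double_primitive[OF ab cd m n k A B f])
  then show "f ((a + b) / 2, (c + d) / 2)
     - 1 / (d - c) * (LINT v:{c..d}|lebesgue. f ((a + b) / 2, v))
     - 1 / (b - a) * (LINT u:{a..b}|lebesgue. f (u, (c + d) / 2))
     + 1 / ((b - a) * (d - c)) * (LINT u:{a..b}|lebesgue. (LINT v:{c..d}|lebesgue. f (u, v)))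
     = 1 / ((b - a) * (d - c)) *
       (LINT t:{a..b}|lebesgue. (LINT s:{c..d}|lebesgue.
          p x t * q y s *
          mixed_partial \<Delta> f
            ((b - t) / (b - a) * a + (t - a) / (b - a) * b,
             (d - s) / (d - c) * c + (s - c) / (d - c) * d)))"
    unfolding rhs m_def n_def .
qed

end
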